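(* Let $t$ be an indeterminate. For every integer $n\ge 0$, $$1+\sum_{k=0}^n t^k \left( L_{k-1} +(t-1)L_{k+1}\right) =t^{n+1}L_{n+1},$$ where $L_k$ ($k\ge 0$) are the Lucas numbers and, by convention in this formula, $L_{-1}:=0$.
   Context: The Lucas numbers $L_k$ ($k\ge 0$) satisfy $L_{n+2}=L_{n+1}+L_n$ for $n\ge 0$, with $L_0=2$, $L_1=1$. The value $L_{-1}=0$ is a convention made only for this formula (it is not the value obtained by extending the recurrence backwards). *)

theory Defs
  imports "HOL-Computational_Algebra.Polynomial"
begin

fun lucas :: "nat \<Rightarrow> nat" where
  "lucas 0 = 2"
| "lucas (Suc 0) = 1"
| "lucas (Suc (Suc n)) = lucas (Suc n) + lucas n"

(* Lucas numbers with the convention L_{-1} = 0. This is not the backward extension of the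
   recurrence (which would give L_{-1} = -1). Indices below -1 are never used. *)
definition lucas_conv :: "int \<Rightarrow> int" where
  "lucas_conv k = (if k < 0 then 0 else int (lucas (nat k)))"

abbreviation indet :: "int poly" where
  "indet \<equiv> [:0, 1:]"

end

theory Submission
  imports Defs
begin

text \<open>The sum telescopes: for \<open>k\<close> at least 1, the recurrence turns the k-th term
  into t^(k+1) L_(k+1) - t^k L_k. The term at 0 is t - 1, whose -1 cancels the leading 1.\<close>

lemma lucas_conv_of_nat: "lucas_conv (int k) = int (lucas k)"
  by (simp add: lucas_conv_def)

theorem mainTheorem6:
  fixes n :: nat
  shows "1 + (\<Sum>k=0..n. indet ^ k *
            (of_int (lucas_conv (int k - 1)) + (indet - 1) * of_int (lucas_conv (int k + 1))))
         = indet ^ (n + 1) * of_int (lucas_conv (int n + 1))"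
proof (induction n)
  case 0
  \<comment> \<open>The only use of L_(-1) = 0: the value -1 would give t - 1 instead of t.\<close>
  show ?case by (simp add: lucas_conv_def)
next
  case (Suc n)
  \<comment> \<open>Keeping \<open>t\<close> opaque stops the simplifier from computing with
    \<open>pCons\<close> coefficients.\<close>
  define t where "t = indet"
  have idx: "int (Suc n) - 1 = int n" "int (Suc n) + 1 = int (Suc (Suc n))"
    "int n + 1 = int (Suc n)" by simp_all
  have "1 + (\<Sum>k=0..Suc n. t ^ k *
            (of_int (lucas_conv (int k - 1)) + (t - 1) * of_int (lucas_conv (int k + 1))))
        = t ^ Suc n * of_nat (lucas (Suc n))
          + t ^ Suc n * (of_nat (lucas n) + (t - 1) * of_nat (lucas (Suc (Suc n))))"
    using Suc.IH unfolding sum.atLeast0_atMost_Suc idx lucas_conv_of_nat t_def [symmetric]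
    by (simp only: add.assoc [symmetric] of_int_of_nat_eq Suc_eq_plus1)
  also have "\<dots> = t ^ Suc (Suc n) * of_nat (lucas (Suc (Suc n)))"
    \<comment> \<open>L_(n+1) + L_n cancels against -L_(n+2), leaving the term with the extra factor
      \<open>t\<close>.\<close>
    by (simp add: algebra_simps)
  finally show ?case
    unfolding idx lucas_conv_of_nat t_def by (simp only: of_int_of_nat_eq Suc_eq_plus1)
qed

end
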